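(* Let $b^*\sim a^*$ be a gap pair with gap value $r^*\ge0$, and suppose the left Bregman reach of $B$ at $b^*\in B$ is at least $r>r^*$. Suppose $f$ is $1$-coercive. Then there exist $\delta>0$ and $0<\ell<1$ such that $$D(b,a^+)\ge D(b^+,a^+)+\ell D(b,b^+)$$ for every $rl$-building block $b\to a^+\to b^+$ with $\|b^+-b^*\|<\delta$ and $\|a^+-a^*\|<\delta$.
   Context: Setting: $f:\mathbb R^d\to\mathbb R\cup\{+\infty\}$ is a convex function of Legendre type (in Rockafellar's sense), $G:=\mathrm{int}(\mathrm{dom} f)$, $f$ is of class $C^2$ on $G$ and $\nabla^2f(x)\succ0$ for all $x\in G$. The Bregman distance is $D(x,y)=f(x)-f(y)-\langle\nabla f(y),x-y\rangle$ for $y\in G$ and $D(x,y)=+\infty$ otherwise. $A,B\subset G$ are nonempty, closed and bounded. $f$ is $1$-coercive if $f(x)/\|x\|\to\infty$ as $\|x\|\to\infty$. Projections: $\overleftarrow{P}_B(a)=\mathrm{argmin}\{D(b',a):b'\in B\}$; $\overrightarrow{P}_A(b)=\mathrm{argmin}\{D(b,a'):a'\in A\}$ (set-valued). An $rl$-building block $b\to a^+\to b^+$ consists of $b\in B$, $a^+\in\overrightarrow{P}_A(b)$, $b^+\in\overleftarrow{P}_B(a^+)$. For $b^*\in B$, $a^*\in A$, $b^*\sim a^*$ (gap pair) means $a^*\in\overrightarrow{P}_A(b^* )$ and $b^*\in\overleftarrow{P}_B(a^* )$; its gap value $r^*\ge0$ is defined by $D(b^*,a^* )=\frac12r^{*2}$.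 Left Bregman reach: left Bregman balls are $\overleftarrow{\mathcal B}(a,r)=\{x:D(x,a)\le\frac12r^2\}$. Let $b^+\in\overleftarrow{P}_B(a^+)$ with $a^+\in G\setminus B$. The left Bregman geodesic (perpendicular) is the curve $a_\lambda=(\nabla f)^{-1}(\lambda\nabla f(a^+)+(1-\lambda)\nabla f(b^+))$, for all $\lambda\geq 0$ for which it is defined, and $r_\lambda\ge0$ is given by $D(b^+,a_\lambda)=\frac12r_\lambda^2$, so that $b^+\in\partial\overleftarrow{\mathcal B}(a_\lambda,r_\lambda)$. With $d=\nabla^2f(b^+)^{-1}(\nabla f(a^+)-\nabla f(b^+))$, the left Bregman reach $\overleftarrow{R}(b^+,d)\in(0,\infty]$ of $B$ at $b^+$ in direction $d$ is the largest (supremal) $r_\lambda$ for which $\overleftarrow{\mathcal B}(a_\lambda,r_\lambda)$ has no points of $B$ in its interior; it is set to $\infty$ if no ball along the geodesic has points of $B$ in its interior. $B$ has left Bregman reach at least $r>0$ at $b^*\in B$ if there is a neighborhood $U$ of $b^*$ such that $\overleftarrow{R}(b^+,d)\ge r$ for every $b^+\in\overleftarrow{P}_B(a^+)\cap U$ with some $a^+\in G\setminus B$ and the associated $d$. *)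

theory Defs
  imports "HOL-Analysis.Analysis"
begin

text \<open>A function with values in the reals extended by plus infinity is modelled as an
  \<^typ>\<open>ereal\<close>-valued function that never takes the value minus infinity (part of
  \<open>convex_fun\<close> below). All derivatives are those of its real part, and are only
  meaningful on the interior of the effective domain.\<close>

definition dom_eff :: "('a::euclidean_space \<Rightarrow> ereal) \<Rightarrow> 'a set" where
  "dom_eff f = {x. f x < \<infinity>}"

definition int_dom :: "('a::euclidean_space \<Rightarrow> ereal) \<Rightarrow> 'a set" where
  "int_dom f = interior (dom_eff f)"

definition re_part :: "('a::euclidean_space \<Rightarrow> ereal) \<Rightarrow> 'a \<Rightarrow> real" where
  "re_part f x = real_of_ereal (f x)"

definition grad :: "('a::euclidean_space \<Rightarrow> ereal) \<Rightarrow> 'a \<Rightarrow> 'a" where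
  "grad f x = (THE v. GDERIV (re_part f) x :> v)"

text \<open>The Hessian at a point is the linear map obtained by differentiating the gradient.\<close>

definition hess :: "('a::euclidean_space \<Rightarrow> ereal) \<Rightarrow> 'a \<Rightarrow> 'a \<Rightarrow> 'a" where
  "hess f x = frechet_derivative (grad f) (at x)"

definition convex_fun :: "('a::euclidean_space \<Rightarrow> ereal) \<Rightarrow> bool" where
  "convex_fun f \<longleftrightarrow> (\<forall>x. f x \<noteq> -\<infinity>) \<and> convex_on (dom_eff f) (re_part f)"

text \<open>Rockafellar, Convex Analysis, Section 26: the pair consisting of the interior \<open>C\<close> of
  the effective domain and \<open>f\<close> is of Legendre type if \<open>C\<close> is nonempty (it is open and convex
  anyway), \<open>f\<close> is strictly convex and differentiable on \<open>C\<close>, and the gradient blows up at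
  the boundary of \<open>C\<close>. This constrains \<open>f\<close> on \<open>C\<close> only, so lower semicontinuity at
  the boundary is not part of the notion.\<close>

definition legendre_type :: "('a::euclidean_space \<Rightarrow> ereal) \<Rightarrow> bool" where
  "legendre_type f \<longleftrightarrow>
     int_dom f \<noteq> {} \<and>
     (\<forall>x\<in>int_dom f. \<forall>y\<in>int_dom f. \<forall>t. x \<noteq> y \<and> 0 < t \<and> t < 1 \<longrightarrow>
        re_part f ((1 - t) *\<^sub>R x + t *\<^sub>R y) < (1 - t) * re_part f x + t * re_part f y) \<and>
     (\<forall>x\<in>int_dom f. re_part f differentiable (at x)) \<and>
     (\<forall>u x. (\<forall>n. u n \<in> int_dom f) \<and> u \<longlonglongrightarrow> x \<and> x \<in> frontier (int_dom f) \<longrightarrow>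
        filterlim (\<lambda>n. norm (grad f (u n))) at_top sequentially)"

definition C2_on_int_dom :: "('a::euclidean_space \<Rightarrow> ereal) \<Rightarrow> bool" where
  "C2_on_int_dom f \<longleftrightarrow>
     (\<forall>x\<in>int_dom f. re_part f differentiable (at x)) \<and>
     (\<forall>x\<in>int_dom f. grad f differentiable (at x)) \<and>
     continuous_on (int_dom f) (\<lambda>x. Blinfun (hess f x))"

definition hess_pos_def :: "('a::euclidean_space \<Rightarrow> ereal) \<Rightarrow> bool" where
  "hess_pos_def f \<longleftrightarrow> (\<forall>x\<in>int_dom f. \<forall>h. h \<noteq> 0 \<longrightarrow> 0 < hess f x h \<bullet> h)"

definition one_coercive :: "('a::euclidean_space \<Rightarrow> ereal) \<Rightarrow> bool" where
  "one_coercive f \<longleftrightarrow> ((\<lambda>x. f x / ereal (norm x)) \<longlongrightarrow> \<infinity>) at_infinity"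

definition bregman :: "('a::euclidean_space \<Rightarrow> ereal) \<Rightarrow> 'a \<Rightarrow> 'a \<Rightarrow> ereal" where
  "bregman f x y =
     (if y \<in> int_dom f then f x - f y - ereal (grad f y \<bullet> (x - y)) else \<infinity>)"

definition left_proj :: "('a::euclidean_space \<Rightarrow> ereal) \<Rightarrow> 'a set \<Rightarrow> 'a \<Rightarrow> 'a set" where
  "left_proj f B a = {b. is_arg_min (\<lambda>b'. bregman f b' a) (\<lambda>b'. b' \<in> B) b}"

definition right_proj :: "('a::euclidean_space \<Rightarrow> ereal) \<Rightarrow> 'a set \<Rightarrow> 'a \<Rightarrow> 'a set" where
  "right_proj f A b = {a. is_arg_min (\<lambda>a'. bregman f b a') (\<lambda>a'. a' \<in> A) a}"

definition rl_building_block ::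
  "('a::euclidean_space \<Rightarrow> ereal) \<Rightarrow> 'a set \<Rightarrow> 'a set \<Rightarrow> 'a \<Rightarrow> 'a \<Rightarrow> 'a \<Rightarrow> bool" where
  "rl_building_block f A B b a b' \<longleftrightarrow> b \<in> B \<and> a \<in> right_proj f A b \<and> b' \<in> left_proj f B a"

definition gap_pair ::
  "('a::euclidean_space \<Rightarrow> ereal) \<Rightarrow> 'a set \<Rightarrow> 'a set \<Rightarrow> 'a \<Rightarrow> 'a \<Rightarrow> bool" where
  "gap_pair f A B b a \<longleftrightarrow> b \<in> B \<and> a \<in> A \<and> a \<in> right_proj f A b \<and> b \<in> left_proj f B a"

definition left_ball :: "('a::euclidean_space \<Rightarrow> ereal) \<Rightarrow> 'a \<Rightarrow> real \<Rightarrow> 'a set" where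
  "left_ball f a r = {x. bregman f x a \<le> ereal (r\<^sup>2 / 2)}"

definition left_direction :: "('a::euclidean_space \<Rightarrow> ereal) \<Rightarrow> 'a \<Rightarrow> 'a \<Rightarrow> 'a" where
  "left_direction f b a = inv (hess f b) (grad f a - grad f b)"

text \<open>The left geodesic is parametrised by its foot point \<open>b\<close> and its initial direction \<open>d\<close>.
  For \<open>d = left_direction f b a\<close> it is the curve through \<open>a\<close> given by
  affine combinations of the gradients at \<open>a\<close> and \<open>b\<close>; see \<open>left_geodesic_direction\<close>.
  The parameters for which it is defined are collected in \<open>left_params\<close>.\<close>

definition left_params :: "('a::euclidean_space \<Rightarrow> ereal) \<Rightarrow> 'a \<Rightarrow> 'a \<Rightarrow> real set" where
  "left_params f b d = {t. 0 \<le> t \<and> grad f b + t *\<^sub>R hess f b d \<in> grad f ` int_dom f}"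

definition left_geodesic :: "('a::euclidean_space \<Rightarrow> ereal) \<Rightarrow> 'a \<Rightarrow> 'a \<Rightarrow> real \<Rightarrow> 'a" where
  "left_geodesic f b d t = inv_into (int_dom f) (grad f) (grad f b + t *\<^sub>R hess f b d)"

definition left_radius :: "('a::euclidean_space \<Rightarrow> ereal) \<Rightarrow> 'a \<Rightarrow> 'a \<Rightarrow> real \<Rightarrow> real" where
  "left_radius f b d t = sqrt (2 * real_of_ereal (bregman f b (left_geodesic f b d t)))"

definition left_free ::
  "('a::euclidean_space \<Rightarrow> ereal) \<Rightarrow> 'a set \<Rightarrow> 'a \<Rightarrow> 'a \<Rightarrow> real \<Rightarrow> bool" where
  "left_free f B b d t \<longleftrightarrow>
     interior (left_ball f (left_geodesic f b d t) (left_radius f b d t)) \<inter> B = {}"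

definition left_reach ::
  "('a::euclidean_space \<Rightarrow> ereal) \<Rightarrow> 'a set \<Rightarrow> 'a \<Rightarrow> 'a \<Rightarrow> ereal" where
  "left_reach f B b d =
     (if \<forall>t\<in>left_params f b d. left_free f B b d t then \<infinity>
      else SUP t\<in>{t\<in>left_params f b d. left_free f B b d t}. ereal (left_radius f b d t))"

definition left_reach_at_least ::
  "('a::euclidean_space \<Rightarrow> ereal) \<Rightarrow> 'a set \<Rightarrow> 'a \<Rightarrow> real \<Rightarrow> bool" where
  "left_reach_at_least f B b0 r \<longleftrightarrow>
     (\<exists>U. open U \<and> b0 \<in> U \<and>
        (\<forall>a\<in>int_dom f - B. \<forall>b\<in>left_proj f B a \<inter> U.
           ereal r \<le> left_reach f B b (left_direction f b a)))"

lemma hess_left_direction: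
  assumes "C2_on_int_dom f" "hess_pos_def f" "b \<in> int_dom f"
  shows "hess f b (left_direction f b a) = grad f a - grad f b"
proof -
  have lin: "linear (hess f b)"
    using assms unfolding C2_on_int_dom_def hess_def
    by (blast intro: linear_frechet_derivative)
  have "inj (hess f b)"
    unfolding linear_injective_0[OF lin]
    using assms(2,3) unfolding hess_pos_def_def by fastforce
  then have "surj (hess f b)"
    using lin linear_injective_imp_surjective by blast
  then show ?thesis
    unfolding left_direction_def by (simp add: surj_f_inv_f)
qed

lemma left_geodesic_direction:
  assumes "C2_on_int_dom f" "hess_pos_def f" "b \<in> int_dom f"
  shows "left_geodesic f b (left_direction f b a) t =
      inv_into (int_dom f) (grad f) (t *\<^sub>R grad f a + (1 - t) *\<^sub>R grad f b)"
    and "left_params f b (left_direction f b a) =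
      {t. 0 \<le> t \<and> t *\<^sub>R grad f a + (1 - t) *\<^sub>R grad f b \<in> grad f ` int_dom f}"
  unfolding left_geodesic_def left_params_def hess_left_direction[OF assms]
  by (simp_all add: algebra_simps)

end

theory Submission
  imports Defs
begin

(* Put c = grad f a - grad f b' and let a_t be the point of the left geodesic with
   grad f a_t = grad f b' + t c. Then
     D(x, a_t) - D(b', a_t) = D(x, b') - t <c, x - b'>,
   so freeness of the ball at parameter t says D(b, b') >= t <c, b - b'> on B, and at t = 1 the
   identity turns this into the three-point inequality with l = 1 - 1/t. It remains to find a free
   parameter exceeding 1 by a uniform amount. The radius is monotone along the geodesic, and by
   invariance of domain grad f is a homeomorphism onto an open set, so for some e > 0 the radius
   at 1 + e stays below r for all (b', a) near (b*, a* ); any free parameter whose radius is close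
   to r must then exceed 1 + e. *)

section \<open>Real-valued Bregman distance and the gradient vector\<close>

definition bregman_real :: "('a::euclidean_space \<Rightarrow> ereal) \<Rightarrow> 'a \<Rightarrow> 'a \<Rightarrow> real" where
  "bregman_real f x y = re_part f x - re_part f y - grad f y \<bullet> (x - y)"

lemma open_int_dom: "open (int_dom f)"
  by (simp add: int_dom_def)

lemma convex_int_dom: "convex_fun f \<Longrightarrow> convex (int_dom f)"
  unfolding convex_fun_def int_dom_def by (blast intro: convex_interior convex_on_imp_convex)

lemma ereal_re_part:
  assumes "convex_fun f" "x \<in> int_dom f"
  shows "f x = ereal (re_part f x)"
proof -
  have "f x \<noteq> \<infinity>"
    using assms(2) interior_subset unfolding int_dom_def dom_eff_def by fastforce
  moreover have "f x \<noteq> -\<infinity>"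
    using assms(1) unfolding convex_fun_def by blast
  ultimately show ?thesis
    unfolding re_part_def by (cases "f x") auto
qed

lemma bregman_eq_bregman_real:
  assumes "convex_fun f" "x \<in> int_dom f" "y \<in> int_dom f"
  shows "bregman f x y = ereal (bregman_real f x y)"
  unfolding bregman_def bregman_real_def
  using assms by (simp add: ereal_re_part)

text \<open>\<open>grad\<close> is a definite description, so existence and uniqueness are both
  needed: the vector of values on the basis represents the derivative, and inner products determine
  that vector.\<close>

lemma gderiv_grad:
  assumes "re_part f differentiable (at x)"
  shows "GDERIV (re_part f) x :> grad f x"
proof -
  obtain f' where f': "(re_part f has_derivative f') (at x)"
    using assms unfolding differentiable_def by blast
  interpret bounded_linear f'
    using f' has_derivative_bounded_linear by blast
  define v where "v = (\<Sum>i\<in>Basis. f' i *\<^sub>R i)"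
  have "f' h = h \<bullet> v" for h
  proof -
    have "f' h = f' (\<Sum>i\<in>Basis. (h \<bullet> i) *\<^sub>R i)"
      by (simp add: euclidean_representation)
    also have "\<dots> = h \<bullet> v"
      unfolding v_def by (simp add: sum scaleR inner_sum_right mult.commute)
    finally show ?thesis .
  qed
  then have v: "GDERIV (re_part f) x :> v"
    using f' unfolding gderiv_def by (metis (no_types, lifting) ext)
  have "w = v" if "GDERIV (re_part f) x :> w" for w
  proof -
    have "(\<lambda>h. h \<bullet> w) = (\<lambda>h. h \<bullet> v)"
      using that v unfolding gderiv_def by (rule has_derivative_unique)
    then show ?thesis
      by (metis vector_eq_ldot)
  qed
  with v show ?thesis
    unfolding grad_def by (rule theI)
qed

section \<open>Positivity of the distance and inversion of the gradient\<close>

locale legendre_C2 =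
  fixes f :: "'a::euclidean_space \<Rightarrow> ereal"
  assumes convex: "convex_fun f"
    and legendre: "legendre_type f"
    and C2: "C2_on_int_dom f"
    and pos_def: "hess_pos_def f"
begin

lemma continuous_on_re_part: "continuous_on (int_dom f) (re_part f)"
  using C2 unfolding C2_on_int_dom_def
  by (meson continuous_at_imp_continuous_on differentiable_imp_continuous_within)

lemma continuous_on_grad: "continuous_on (int_dom f) (grad f)"
  using C2 unfolding C2_on_int_dom_def
  by (meson continuous_at_imp_continuous_on differentiable_imp_continuous_within)

text \<open>By convexity the difference quotients from \<open>y\<close> towards \<open>x\<close>
  stay below \<open>re_part f x - re_part f y\<close>; their limit is the directional derivative at
  \<open>y\<close>.\<close>

lemma bregman_real_nonneg:
  assumes x: "x \<in> int_dom f" and y: "y \<in> int_dom f"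
  shows "0 \<le> bregman_real f x y"
proof -
  let ?p = "\<lambda>t::real. y + t *\<^sub>R (x - y)"
  have der: "(re_part f has_derivative (\<lambda>h. h \<bullet> grad f y)) (at y)"
    using gderiv_grad C2 y unfolding C2_on_int_dom_def gderiv_def by blast
  have "((\<lambda>t. re_part f (?p t)) has_derivative (\<lambda>t. (t *\<^sub>R (x - y)) \<bullet> grad f y)) (at 0)"
    by (rule has_derivative_compose[of ?p _ _ _ "re_part f" "\<lambda>h. h \<bullet> grad f y"])
       (auto intro!: derivative_eq_intros simp: der)
  then have "((\<lambda>t. re_part f (?p t)) has_real_derivative (x - y) \<bullet> grad f y) (at 0)"
    by (simp add: has_field_derivative_def mult_commute_abs mult.commute)
  then have "((\<lambda>t. (re_part f (?p t) - re_part f y) / t) \<longlongrightarrow> (x - y) \<bullet> grad f y) (at 0)"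
    by (simp add: has_field_derivative_iff)
  \<comment> \<open>Convexity controls the quotients only for \<open>t\<close> between 0 and 1,
    hence the one-sided limit.\<close>
  then have lim: "((\<lambda>t. (re_part f (?p t) - re_part f y) / t) \<longlongrightarrow> (x - y) \<bullet> grad f y) (at_right 0)"
    by (rule filterlim_mono) (auto intro: at_le)
  have cvx: "convex_on (int_dom f) (re_part f)"
    using convex convex_int_dom unfolding convex_fun_def int_dom_def
    by (meson convex_on_subset interior_subset)
  have "\<forall>\<^sub>F t in at_right 0. (re_part f (?p t) - re_part f y) / t \<le> re_part f x - re_part f y"
    unfolding eventually_at_right_field
  proof (intro exI conjI allI impI)
    fix t :: real assume t: "0 < t" "t < 1"
    have "re_part f ((1 - t) *\<^sub>R y + t *\<^sub>R x) \<le> (1 - t) * re_part f y + t * re_part f x"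
      using convex_onD[OF cvx] t x y by simp
    moreover have "(1 - t) *\<^sub>R y + t *\<^sub>R x = ?p t"
      by (simp add: algebra_simps)
    ultimately show "(re_part f (?p t) - re_part f y) / t \<le> re_part f x - re_part f y"
      using t by (simp add: field_simps)
  qed simp
  from tendsto_upperbound[OF lim this] show ?thesis
    unfolding bregman_real_def by (simp add: inner_commute)
qed

text \<open>Strictness comes from the midpoint \<open>m\<close>: the gradient inequality at
  \<open>y\<close> is applied to \<open>m\<close>, where strict convexity puts
  \<open>re_part f m\<close> strictly below the mean.\<close>

lemma bregman_real_pos:
  assumes x: "x \<in> int_dom f" and y: "y \<in> int_dom f" and "x \<noteq> y"
  shows "0 < bregman_real f x y"
proof -
  define m where "m = (1 - 1/2) *\<^sub>R x + (1/2) *\<^sub>R y"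
  have "m \<in> int_dom f"
    unfolding m_def using convexD[OF convex_int_dom[OF convex] x y] by simp
  then have "0 \<le> bregman_real f m y"
    using bregman_real_nonneg y by blast
  moreover have "re_part f m < (1 - 1/2) * re_part f x + (1/2) * re_part f y"
    using legendre assms unfolding legendre_type_def m_def
    by (meson half_gt_zero_iff less_divide_eq_1_pos zero_less_one one_less_numeral_iff
        semiring_norm(76) zero_less_divide_1_iff zero_less_numeral divide_less_eq_1_pos)
  moreover have "grad f y \<bullet> (m - y) = grad f y \<bullet> (x - y) / 2"
    unfolding m_def by (simp add: inner_diff_right inner_add_right field_simps)
  ultimately show ?thesis
    unfolding bregman_real_def by (simp add: field_simps)
qed

lemma bregman_real_add_commute:
  "bregman_real f x y + bregman_real f y x = (grad f x - grad f y) \<bullet> (x - y)"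
  unfolding bregman_real_def by (simp add: algebra_simps inner_diff_right inner_diff_left)

text \<open>Equal gradients make the symmetrised distance of \<open>bregman_real_add_commute\<close>
  vanish, while for distinct points both summands are positive.\<close>

lemma inj_on_grad: "inj_on (grad f) (int_dom f)"
proof (rule inj_onI, rule ccontr)
  fix x y assume *: "x \<in> int_dom f" "y \<in> int_dom f" "grad f x = grad f y" "x \<noteq> y"
  then show False
    using bregman_real_add_commute[of x y] bregman_real_pos[of x y] bregman_real_pos[of y x]
    by auto
qed

lemma open_grad_image: "open (grad f ` int_dom f)"
  using invariance_of_domain[OF continuous_on_grad open_int_dom inj_on_grad] .

text \<open>Invariance of domain yields some continuous inverse \<open>g\<close>; on the image it
  agrees with \<open>inv_into\<close>, through which \<open>left_geodesic\<close> is
  defined.\<close>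

lemma continuous_on_inv_grad:
  "continuous_on (grad f ` int_dom f) (inv_into (int_dom f) (grad f))"
proof -
  obtain g where g: "homeomorphism (int_dom f) (grad f ` int_dom f) (grad f) g"
    using invariance_of_domain_homeomorphism[OF open_int_dom continuous_on_grad _ inj_on_grad]
    by blast
  then have "g y = inv_into (int_dom f) (grad f) y" if "y \<in> grad f ` int_dom f" for y
    using that inj_on_grad unfolding homeomorphism_def by auto
  with g show ?thesis
    unfolding homeomorphism_def by (metis continuous_on_cong)
qed

lemma continuous_on_bregman_real:
  assumes "continuous_on S u" "continuous_on S v"
    and "u ` S \<subseteq> int_dom f" "v ` S \<subseteq> int_dom f"
  shows "continuous_on S (\<lambda>s. bregman_real f (u s) (v s))"
  unfolding bregman_real_def
  using assms continuous_on_compose2[OF continuous_on_re_part]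
    continuous_on_compose2[OF continuous_on_grad]
  by (intro continuous_intros) auto

section \<open>Distances along a left geodesic\<close>

lemma bregman_real_diff:
  assumes "grad f z = grad f b + t *\<^sub>R c"
  shows "bregman_real f x z - bregman_real f b z = bregman_real f x b - t * (c \<bullet> (x - b))"
  using assms unfolding bregman_real_def by (simp add: algebra_simps inner_diff_right inner_add_left)

text \<open>Beyond \<open>y\<close> the distance from \<open>b\<close> grows by
  \<open>bregman_real f y z\<close> plus \<open>t - s\<close> times the product of \<open>c\<close>
  and \<open>y - b\<close>. The symmetrised distance of \<open>y\<close> and \<open>b\<close> is
  \<open>s\<close> times that product, so the product is nonnegative when \<open>s > 0\<close>; for
  \<open>s = 0\<close> the point \<open>y\<close> is \<open>b\<close> itself.\<close>

lemma bregman_real_mono_geodesic: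
  assumes "b \<in> int_dom f" "y \<in> int_dom f" "z \<in> int_dom f"
    and y: "grad f y = grad f b + s *\<^sub>R c" and z: "grad f z = grad f b + t *\<^sub>R c"
    and "0 \<le> s" "s \<le> t"
  shows "bregman_real f b y \<le> bregman_real f b z"
proof (cases "s = 0")
  case True
  then have "y = b"
    using y assms(1,2) inj_on_grad by (auto simp: inj_on_def)
  then show ?thesis
    using bregman_real_nonneg[OF assms(1,3)] by (simp add: bregman_real_def)
next
  case False
  have "bregman_real f y b + bregman_real f b y = s * (c \<bullet> (y - b))"
    using bregman_real_add_commute[of y b] y by simp
  then have "0 \<le> s * (c \<bullet> (y - b))"
    using bregman_real_nonneg assms(1,2) by (metis add_nonneg_nonneg)
  then have "0 \<le> c \<bullet> (y - b)"
    using False \<open>0 \<le> s\<close> by (simp add: zero_le_mult_iff)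
  then have "s * (c \<bullet> (y - b)) \<le> t * (c \<bullet> (y - b))"
    using \<open>s \<le> t\<close> by (rule mult_right_mono[rotated])
  moreover have "bregman_real f b z - bregman_real f b y
      = bregman_real f y z + (t - s) * (c \<bullet> (y - b))"
    using y z unfolding bregman_real_def
    by (simp add: algebra_simps inner_diff_right inner_add_left)
  ultimately show ?thesis
    using bregman_real_nonneg[OF assms(2,3)] by (simp add: algebra_simps)
qed

section \<open>Free balls, reach and uniform extension of geodesics\<close>

lemma left_geodesic_grad:
  assumes "b \<in> int_dom f" "t \<in> left_params f b (left_direction f b a)"
  shows "left_geodesic f b (left_direction f b a) t \<in> int_dom f"
    and "grad f (left_geodesic f b (left_direction f b a) t)
      = grad f b + t *\<^sub>R (grad f a - grad f b)"
  using assms unfolding left_params_def left_geodesic_def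
    hess_left_direction[OF C2 pos_def assms(1)]
  by (auto intro: inv_into_into f_inv_into_f)

lemma left_radius_eq:
  assumes "b \<in> int_dom f" "left_geodesic f b d t \<in> int_dom f"
  shows "left_radius f b d t = sqrt (2 * bregman_real f b (left_geodesic f b d t))"
  unfolding left_radius_def using assms by (simp add: bregman_eq_bregman_real convex)

text \<open>By \<open>bregman_real_diff\<close>, a failure of the inequality puts \<open>x\<close>
  into a strict sublevel set \<open>W\<close>. This set is open and contained in the ball, so
  \<open>x\<close> would lie in the interior of a free ball.\<close>

lemma left_free_imp_le:
  assumes B: "B \<subseteq> int_dom f" and b: "b \<in> int_dom f"
    and t: "t \<in> left_params f b (left_direction f b a)"
    and free: "left_free f B b (left_direction f b a) t"
    and x: "x \<in> B"
  shows "t * ((grad f a - grad f b) \<bullet> (x - b)) \<le> bregman_real f x b"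
proof (rule ccontr)
  define z where "z = left_geodesic f b (left_direction f b a) t"
  have z: "z \<in> int_dom f" "grad f z = grad f b + t *\<^sub>R (grad f a - grad f b)"
    unfolding z_def using left_geodesic_grad[OF b t] by auto
  define W where "W = {w \<in> int_dom f. bregman_real f w z < bregman_real f b z}"
  assume "\<not> ?thesis"
  then have "x \<in> W"
    using bregman_real_diff[OF z(2), of x] x B unfolding W_def by auto
  have "open W"
  proof -
    have "W = int_dom f \<inter> (\<lambda>w. bregman_real f w z) -` {..<bregman_real f b z}"
      unfolding W_def by auto
    moreover have "continuous_on (int_dom f) (\<lambda>w. bregman_real f w z)"
      using z(1) by (intro continuous_on_bregman_real continuous_intros) auto
    ultimately show ?thesis
      by (metis continuous_open_preimage open_int_dom open_lessThan)
  qed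
  moreover have "W \<subseteq> left_ball f z (left_radius f b (left_direction f b a) t)"
  proof
    fix w assume w: "w \<in> W"
    have "(left_radius f b (left_direction f b a) t)\<^sup>2 / 2 = bregman_real f b z"
      using left_radius_eq[OF b] z(1) bregman_real_nonneg[OF b z(1)] unfolding z_def by simp
    with w z(1) show "w \<in> left_ball f z (left_radius f b (left_direction f b a) t)"
      unfolding left_ball_def W_def by (simp add: bregman_eq_bregman_real convex)
  qed
  ultimately have "x \<in> interior (left_ball f z (left_radius f b (left_direction f b a) t))"
    using \<open>x \<in> W\<close> interior_maximal by blast
  with x free show False
    unfolding left_free_def z_def by blast
qed

text \<open>Freeness at \<open>t\<close> itself is not claimed: a free parameter \<open>s\<close> at
  or beyond \<open>t\<close> suffices, since the inequality passes from \<open>s\<close> down to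
  \<open>t\<close>.\<close>

lemma left_reach_imp_le:
  assumes B: "B \<subseteq> int_dom f" and b: "b \<in> int_dom f"
    and reach: "ereal r \<le> left_reach f B b (left_direction f b a)"
    and z: "z \<in> int_dom f" "grad f z = grad f b + t *\<^sub>R (grad f a - grad f b)"
    and t: "0 \<le> t" and radius: "sqrt (2 * bregman_real f b z) < r"
    and x: "x \<in> B"
  shows "t * ((grad f a - grad f b) \<bullet> (x - b)) \<le> bregman_real f x b"
proof -
  let ?d = "left_direction f b a"
  have tp: "t \<in> left_params f b ?d"
    using z t unfolding left_params_def hess_left_direction[OF C2 pos_def b]
    by (metis (mono_tags, lifting) image_eqI mem_Collect_eq)
  have "\<exists>s\<ge>t. s \<in> left_params f b ?d \<and> left_free f B b ?d s"
  proof (cases "\<forall>s\<in>left_params f b ?d. left_free f B b ?d s")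
    case True
    with tp show ?thesis by blast
  next
    case False
    have "ereal r
        \<le> (SUP s\<in>{s\<in>left_params f b ?d. left_free f B b ?d s}. ereal (left_radius f b ?d s))"
      using reach unfolding left_reach_def if_not_P[OF False] .
    \<comment> \<open>The supremum may not be attained; the strict gap below \<open>r\<close> still
      yields a free parameter of larger radius, which by monotonicity lies beyond
      \<open>t\<close>.\<close>
    then have "ereal (sqrt (2 * bregman_real f b z))
        < (SUP s\<in>{s\<in>left_params f b ?d. left_free f B b ?d s}. ereal (left_radius f b ?d s))"
      using radius by (elim less_le_trans[rotated]) simp
    then obtain s where s: "s \<in> left_params f b ?d" "left_free f B b ?d s"
      and less: "sqrt (2 * bregman_real f b z) < left_radius f b ?d s"
      unfolding less_SUP_iff by auto
    note y = left_geodesic_grad[OF b s(1)]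
    have "0 \<le> s"
      using s(1) unfolding left_params_def by simp
    have "\<not> s \<le> t"
      using bregman_real_mono_geodesic[OF b y(1) z(1) y(2) z(2) \<open>0 \<le> s\<close>] less
      unfolding left_radius_eq[OF b y(1)] by auto
    with s show ?thesis
      by (metis linorder_le_cases)
  qed
  then obtain s where s: "t \<le> s" "s \<in> left_params f b ?d" "left_free f B b ?d s"
    by blast
  let ?k = "(grad f a - grad f b) \<bullet> (x - b)"
  have *: "s * ?k \<le> bregman_real f x b"
    using left_free_imp_le[OF B b s(2,3) x] .
  show ?thesis
  \<comment> \<open>Lowering \<open>s\<close> to \<open>t\<close> shrinks the left side only for
    nonnegative \<open>?k\<close>; for negative \<open>?k\<close> that side is nonpositive
    anyway.\<close>
  proof (cases "0 \<le> ?k")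
    case True
    then show ?thesis
      using * mult_right_mono[OF s(1) True] by linarith
  next
    case False
    then have "t * ?k \<le> 0"
      using t by (simp add: mult_nonneg_nonpos)
    also have "0 \<le> bregman_real f x b"
      using bregman_real_nonneg x B b by blast
    finally show ?thesis .
  qed
qed

text \<open>The geodesic point and its distance from the foot depend continuously on both ends and
  on \<open>e\<close> jointly, so the bound at \<open>(a, b, 0)\<close> persists on a product
  neighbourhood. One \<open>e\<close> then serves all nearby pairs.\<close>

lemma geodesic_extension:
  assumes a: "a \<in> int_dom f" and b: "b \<in> int_dom f" and R: "bregman_real f b a < R"
  shows "\<exists>e>0. \<exists>\<delta>>0. \<forall>a' b'. dist a' a < \<delta> \<and> dist b' b < \<delta> \<longrightarrow>
    (\<exists>z\<in>int_dom f. grad f z = grad f b' + (1 + e) *\<^sub>R (grad f a' - grad f b')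
      \<and> bregman_real f b' z < R)"
proof -
  let ?G = "int_dom f" and ?i = "inv_into (int_dom f) (grad f)"
  let ?S = "?G \<times> ?G \<times> (UNIV :: real set)"
  let ?\<Phi> = "\<lambda>(a, b, e). grad f b + (1 + e) *\<^sub>R (grad f a - grad f b)"
  have cont\<Phi>: "continuous_on ?S ?\<Phi>"
    unfolding case_prod_beta
    by (intro continuous_intros continuous_on_compose2[OF continuous_on_grad]) auto
  define T where "T = ?S \<inter> ?\<Phi> -` (grad f ` ?G)"
  have openT: "open T"
    unfolding T_def
    by (intro continuous_open_preimage cont\<Phi> open_Times open_int_dom open_UNIV open_grad_image)
  have "continuous_on T (\<lambda>p. ?i (?\<Phi> p))"
    by (rule continuous_on_compose2[OF continuous_on_inv_grad continuous_on_subset[OF cont\<Phi>]])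
       (auto simp: T_def)
  then have cont: "continuous_on T (\<lambda>p. bregman_real f (fst (snd p)) (?i (?\<Phi> p)))"
    by (intro continuous_on_bregman_real continuous_intros)
       (auto simp: T_def intro!: inv_into_into)
  define V where "V = T \<inter> (\<lambda>p. bregman_real f (fst (snd p)) (?i (?\<Phi> p))) -` {..<R}"
  have "open V"
    unfolding V_def by (intro continuous_open_preimage cont openT) auto
  \<comment> \<open>At \<open>e = 0\<close> the geodesic is at \<open>a\<close>, so this is the
    assumption on \<open>R\<close>.\<close>
  moreover have "(a, b, 0) \<in> V"
    using a b R inj_on_grad unfolding V_def T_def by auto
  ultimately obtain P Q where PQ: "open P" "open Q" "a \<in> P" "(b, 0) \<in> Q" "P \<times> Q \<subseteq> V"
    by (metis open_prod_elim mem_Sigma_iff)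
  then obtain Q1 Q2 where Q: "open Q1" "open Q2" "b \<in> Q1" "0 \<in> Q2" "Q1 \<times> Q2 \<subseteq> Q"
    by (metis open_prod_elim mem_Sigma_iff)
  obtain d1 where d1: "d1 > 0" "\<And>y. dist y a < d1 \<Longrightarrow> y \<in> P"
    using PQ unfolding open_dist by blast
  obtain d2 where d2: "d2 > 0" "\<And>y. dist y b < d2 \<Longrightarrow> y \<in> Q1"
    using Q unfolding open_dist by blast
  obtain d3 where d3: "d3 > 0" "\<And>y. dist y 0 < d3 \<Longrightarrow> y \<in> Q2"
    using Q unfolding open_dist by blast
  have "\<exists>z\<in>?G. grad f z = grad f b' + (1 + d3 / 2) *\<^sub>R (grad f a' - grad f b')
      \<and> bregman_real f b' z < R" if "dist a' a < min d1 d2" "dist b' b < min d1 d2" for a' b'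
  proof -
    have "d3 / 2 \<in> Q2"
      using d3 by simp
    moreover have "a' \<in> P" "b' \<in> Q1"
      using that d1 d2 by auto
    ultimately have "(a', b', d3 / 2) \<in> V"
      using PQ(5) Q(5) by blast
    then show ?thesis
      unfolding V_def T_def
      by (intro bexI[of _ "?i (?\<Phi> (a', b', d3 / 2))"]) (auto intro: inv_into_into simp: f_inv_into_f)
  qed
  then show ?thesis
    using d1(1) d2(1) d3(1)
    by (intro exI[of _ "d3 / 2"] conjI exI[of _ "min d1 d2"]) auto
qed

text \<open>This settles the case \<open>a \<in> B\<close>, about which the reach says
  nothing.\<close>

lemma left_proj_self:
  assumes "B \<subseteq> int_dom f" "a \<in> B" "b \<in> left_proj f B a"
  shows "b = a"
proof (rule ccontr)
  assume "b \<noteq> a"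
  have b: "b \<in> int_dom f" "a \<in> int_dom f" and "\<not> bregman f a a < bregman f b a"
    using assms unfolding left_proj_def is_arg_min_def by auto
  then have "bregman_real f b a \<le> bregman_real f a a"
    by (simp add: bregman_eq_bregman_real convex)
  with bregman_real_pos[OF b \<open>b \<noteq> a\<close>] show False
    by (simp add: bregman_real_def)
qed

end

section \<open>The three-point inequality near a gap pair\<close>

theorem proposition10p1:
  fixes f :: "'a::euclidean_space \<Rightarrow> ereal"
    and A B :: "'a set" and a_star b_star :: 'a and r r_star :: real
  assumes "convex_fun f" and "legendre_type f"
    and "C2_on_int_dom f" and "hess_pos_def f"
    and "A \<subseteq> int_dom f" and "A \<noteq> {}" and "closed A" and "bounded A"
    and "B \<subseteq> int_dom f" and "B \<noteq> {}" and "closed B" and "bounded B"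
    and "gap_pair f A B b_star a_star"
    and "0 \<le> r_star" and "bregman f b_star a_star = ereal (r_star\<^sup>2 / 2)"
    and "r_star < r" and "left_reach_at_least f B b_star r"
    and "one_coercive f"
  shows "\<exists>\<delta>>0. \<exists>l. 0 < l \<and> l < 1 \<and>
    (\<forall>b a b'. rl_building_block f A B b a b' \<and>
        norm (b' - b_star) < \<delta> \<and> norm (a - a_star) < \<delta> \<longrightarrow>
      bregman f b a \<ge> bregman f b' a + ereal l * bregman f b b')"
proof -
  interpret legendre_C2 f
    using assms by unfold_locales
  have stars: "a_star \<in> int_dom f" "b_star \<in> int_dom f"
    using assms(5,9,13) unfolding gap_pair_def by auto
  have "r_star\<^sup>2 < r\<^sup>2"
    using assms(14,16) by (simp add: power_strict_mono)
  then have "bregman_real f b_star a_star < r\<^sup>2 / 2"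
    using assms(15) stars by (simp add: bregman_eq_bregman_real convex)
  from geodesic_extension[OF stars this]
  obtain e \<delta>1 where e: "e > 0" and \<delta>1: "\<delta>1 > 0"
    and ext: "\<And>a b. dist a a_star < \<delta>1 \<Longrightarrow> dist b b_star < \<delta>1 \<Longrightarrow>
      \<exists>z\<in>int_dom f. grad f z = grad f b + (1 + e) *\<^sub>R (grad f a - grad f b)
        \<and> bregman_real f b z < r\<^sup>2 / 2"
    by metis
  obtain U where U: "open U" "b_star \<in> U"
    and reach: "\<And>a b. a \<in> int_dom f - B \<Longrightarrow> b \<in> left_proj f B a \<inter> U \<Longrightarrow>
      ereal r \<le> left_reach f B b (left_direction f b a)"
    using assms(17) unfolding left_reach_at_least_def by metis
  obtain \<delta>2 where \<delta>2: "\<delta>2 > 0" "\<And>y. dist y b_star < \<delta>2 \<Longrightarrow> y \<in> U"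
    using U unfolding open_dist by blast
  \<comment> \<open>With \<open>t = 1 + e\<close> this is \<open>1 - 1/t\<close>, the factor left
    after subtracting an inner product of size at most \<open>1/t\<close> times the
    distance.\<close>
  define l where "l = e / (1 + e)"
  have l: "0 < l" "l < 1"
    using e unfolding l_def by auto
  have "bregman f b a \<ge> bregman f b' a + ereal l * bregman f b b'"
    if block: "rl_building_block f A B b a b'"
      and near: "norm (b' - b_star) < min \<delta>1 \<delta>2" "norm (a - a_star) < min \<delta>1 \<delta>2" for b a b'
  proof -
    have mem: "b \<in> B" "a \<in> A" "b' \<in> B" and proj: "b' \<in> left_proj f B a"
      using block
      unfolding rl_building_block_def right_proj_def left_proj_def is_arg_min_def by auto
    then have G: "b \<in> int_dom f" "a \<in> int_dom f" "b' \<in> int_dom f"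
      using assms(5,9) by auto
    let ?k = "(grad f a - grad f b') \<bullet> (b - b')"
    \<comment> \<open>The geodesic identity at parameter 1, where the geodesic passes through
      \<open>a\<close>.\<close>
    have D: "bregman_real f b a - bregman_real f b' a = bregman_real f b b' - ?k"
      using bregman_real_diff[of a b' 1 "grad f a - grad f b'" b] by simp
    have "(1 + e) * ?k \<le> bregman_real f b b'"
    proof (cases "a \<in> B")
      case True
      \<comment> \<open>Here the gradients at \<open>a\<close> and \<open>b'\<close> coincide, so
        \<open>?k\<close> vanishes.\<close>
      then have "b' = a"
        using left_proj_self[OF assms(9)] proj by blast
      then show ?thesis
        using bregman_real_nonneg G by simp
    next
      case False
      obtain z where z: "z \<in> int_dom f"
          "grad f z = grad f b' + (1 + e) *\<^sub>R (grad f a - grad f b')"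
        and small: "bregman_real f b' z < r\<^sup>2 / 2"
        using ext[of a b'] near by (auto simp: dist_norm)
      have "sqrt (2 * bregman_real f b' z) < r"
        using small assms(14,16) by (intro real_less_lsqrt) auto
      moreover have "ereal r \<le> left_reach f B b' (left_direction f b' a)"
        using reach[of a b'] proj near \<delta>2(2) False G by (auto simp: dist_norm)
      ultimately show ?thesis
        using left_reach_imp_le[OF assms(9) G(3) _ z _ _ mem(1)] e by simp
    qed
    then have "l * bregman_real f b b' \<le> bregman_real f b b' - ?k"
      using e unfolding l_def by (simp add: field_simps)
    with D show ?thesis
      using G by (simp add: bregman_eq_bregman_real convex)
  qed
  then show ?thesis
    using \<delta>1 \<delta>2(1) l by (intro exI[of _ "min \<delta>1 \<delta>2"] conjI exI[of _ l]) auto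
qed

end
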